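(* Let $f:\mathbb{C}\to\mathbb{C}$ be a transcendental entire function. Then $f(\gamma)$ is unbounded for every unbounded curve $\gamma$ in $\mathbb{C}$ if and only if $\infty$ is the Baker omitted value of $f$.
   Context: $\widehat{\mathbb{C}}=\mathbb{C}\cup\{\infty\}$, and $D_r(a)$ is the open ball centered at $a\in\widehat{\mathbb{C}}$ with radius $r$ with respect to the spherical metric. A point $a\in\widehat{\mathbb{C}}$ is an omitted value of $f$ if $f(z)\neq a$ for every $z\in\mathbb{C}$. An omitted value $a\in\widehat{\mathbb{C}}$ of $f$ is a Baker omitted value (bov) if there exists $r_0>0$ such that for all $r$ with $0<r<r_0$, each component of the boundary of $f^{-1}(D_r(a))$ (boundary taken in $\mathbb{C}$) is bounded. An unbounded curve is a curve in $\mathbb{C}$ (the image of an interval under a continuous map into $\mathbb{C}$) which is an unbounded subset of $\mathbb{C}$. *)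

theory Defs
  imports "HOL-Complex_Analysis.Complex_Analysis"
begin

definition transcendental_entire :: "(complex \<Rightarrow> complex) \<Rightarrow> bool" where
  "transcendental_entire f \<longleftrightarrow>
     f holomorphic_on UNIV \<and> \<not> (\<exists>p :: complex poly. \<forall>z. f z = poly p z)"

datatype riemann_sphere = Finite complex | Infinity

text \<open>
  The spherical metric is the great-circle distance between the images on the unit sphere
  under inverse stereographic projection from the north pole; it is the path metric of
  \<open>2 |dz| / (1 + |z|^2)\<close>.
\<close>

fun stereographic :: "riemann_sphere \<Rightarrow> complex \<times> real" where
  "stereographic (Finite z) =
     ((2 / (1 + (cmod z)\<^sup>2)) *\<^sub>R z, ((cmod z)\<^sup>2 - 1) / ((cmod z)\<^sup>2 + 1))"
| "stereographic Infinity = (0, 1)"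

lemma norm_stereographic: "norm (stereographic a) = 1"
proof (cases a)
  case (Finite z)
  define s where "s = (cmod z)\<^sup>2"
  have s: "s + 1 > 0" "1 + s > 0"
    by (auto simp: s_def add_nonneg_pos add_pos_nonneg)
  have "(norm (stereographic a))\<^sup>2 = (2 / (1 + s))\<^sup>2 * s + ((s - 1) / (s + 1))\<^sup>2"
    by (simp add: Finite norm_Pair s_def power_mult_distrib power_divide)
  also have "\<dots> = 1"
  proof -
    have "(2 / (1 + s))\<^sup>2 * s + ((s - 1) / (s + 1))\<^sup>2 = (4 * s + (s - 1)\<^sup>2) / (s + 1)\<^sup>2"
      by (simp add: power_divide add_divide_distrib add.commute)
    also have "4 * s + (s - 1)\<^sup>2 = (s + 1)\<^sup>2"
      by (simp add: power2_eq_square algebra_simps)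
    finally show ?thesis
      using s by simp
  qed
  finally show ?thesis
    using norm_ge_zero[of "stereographic a"] by (simp only: power2_eq_1_iff) linarith
qed (simp add: norm_Pair)

definition spherical_dist :: "riemann_sphere \<Rightarrow> riemann_sphere \<Rightarrow> real" where
  "spherical_dist a b = arccos (stereographic a \<bullet> stereographic b)"

definition spherical_ball :: "riemann_sphere \<Rightarrow> real \<Rightarrow> riemann_sphere set" where
  "spherical_ball a r = {b. spherical_dist a b < r}"

text \<open>
  Functions are taken with values in the sphere, so that \<open>Infinity\<close> can be an omitted value;
  an entire function \<open>f\<close> enters as \<open>Finite \<circ> f\<close>.
\<close>

definition omitted_value :: "(complex \<Rightarrow> riemann_sphere) \<Rightarrow> riemann_sphere \<Rightarrow> bool" where
  "omitted_value g a \<longleftrightarrow> (\<forall>z. g z \<noteq> a)"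

definition baker_omitted_value :: "(complex \<Rightarrow> riemann_sphere) \<Rightarrow> riemann_sphere \<Rightarrow> bool" where
  "baker_omitted_value g a \<longleftrightarrow>
     omitted_value g a \<and>
     (\<exists>r0>0. \<forall>r. 0 < r \<and> r < r0 \<longrightarrow>
        (\<forall>C \<in> components (frontier (g -` spherical_ball a r)). bounded C))"

definition unbounded_curve :: "complex set \<Rightarrow> bool" where
  "unbounded_curve \<Gamma> \<longleftrightarrow>
     (\<exists>(I :: real set) c. is_interval I \<and> continuous_on I c \<and> \<Gamma> = c ` I) \<and> \<not> bounded \<Gamma>"

end

theory Submission
  imports Defs
begin

text \<open>
  Punctured spherical discs about \<open>\<infinity>\<close> are the sets \<open>|w| > R\<close>, so their preimages under a nonconstant
  entire \<open>f\<close> have boundary \<open>|f| = R\<close>. An unbounded component of such a level set lies in an unbounded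
  component of the open set \<open>|f| < R + 1\<close>, which is path connected and so contains an unbounded curve.
  Conversely, an unbounded curve on which \<open>f\<close> is bounded lies in an unbounded component of \<open>|f| < R\<close>
  for some large \<open>R\<close>. By the maximum principle this component is simply connected, and it is not the
  whole plane by Liouville's theorem; the boundary components of an unbounded simply connected
  proper domain are all unbounded.
\<close>

section \<open>Spherical balls about infinity\<close>

text \<open>For \<open>R\<close> \<ge> 0 this is 2 arccot \<open>R\<close>, since half-angle
  formulas turn \<open>cos\<close> \<theta> = (\<open>R\<^sup>2\<close> - 1) /
  (\<open>R\<^sup>2\<close> + 1) into \<open>cot\<close> (\<theta>/2) = \<open>R\<close>.\<close>

definition angle_of_radius :: "real \<Rightarrow> real" where
  "angle_of_radius R = arccos ((R\<^sup>2 - 1) / (R\<^sup>2 + 1))"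

lemma spherical_dist_Infinity: "spherical_dist Infinity (Finite w) = angle_of_radius (cmod w)"
  by (simp add: spherical_dist_def angle_of_radius_def)

text \<open>In this form \<open>R\<close> occurs only once, so bounds and monotonicity in
  \<open>R\<^sup>2\<close> can be read off.\<close>

lemma stereographic_height_eq: "((R::real)\<^sup>2 - 1) / (R\<^sup>2 + 1) = 1 - 2 / (R\<^sup>2 + 1)"
proof -
  have "R\<^sup>2 + 1 \<noteq> 0"
    by (metis add_nonneg_eq_0_iff zero_le_one zero_le_power2 zero_neq_one)
  then show ?thesis
    by (simp add: field_simps)
qed

lemma stereographic_height_bounds:
  fixes R :: real
  shows "-1 \<le> (R\<^sup>2 - 1) / (R\<^sup>2 + 1)" and "(R\<^sup>2 - 1) / (R\<^sup>2 + 1) < 1"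
proof -
  have "0 < R\<^sup>2 + 1"
    by (simp add: add_nonneg_pos)
  then have "0 < 2 / (R\<^sup>2 + 1)" "2 / (R\<^sup>2 + 1) \<le> 2"
    by (auto simp: divide_le_eq)
  then show "-1 \<le> (R\<^sup>2 - 1) / (R\<^sup>2 + 1)" "(R\<^sup>2 - 1) / (R\<^sup>2 + 1) < 1"
    unfolding stereographic_height_eq by linarith+
qed

lemma angle_of_radius_less_iff:
  assumes "0 \<le> R" "0 \<le> S"
  shows "angle_of_radius R < angle_of_radius S \<longleftrightarrow> S < R"
proof -
  have pos: "0 < R\<^sup>2 + 1" "0 < S\<^sup>2 + 1"
    by (simp_all add: add_nonneg_pos)
  have "angle_of_radius R < angle_of_radius S \<longleftrightarrow>
      (S\<^sup>2 - 1) / (S\<^sup>2 + 1) < (R\<^sup>2 - 1) / (R\<^sup>2 + 1)"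
    unfolding angle_of_radius_def
    using stereographic_height_bounds[of R] stereographic_height_bounds[of S]
    by (intro arccos_less_mono) (simp_all add: abs_le_iff)
  also have "\<dots> \<longleftrightarrow> 2 / (R\<^sup>2 + 1) < 2 / (S\<^sup>2 + 1)"
    unfolding stereographic_height_eq by auto
  also have "\<dots> \<longleftrightarrow> S\<^sup>2 < R\<^sup>2"
    using pos by (simp add: field_simps)
  also have "\<dots> \<longleftrightarrow> S < R"
    using assms by (metis power2_less_imp_less power_strict_mono zero_less_numeral)
  finally show ?thesis .
qed

lemma angle_of_radius_pos: "0 < angle_of_radius R"
proof -
  have "arccos 1 < arccos ((R\<^sup>2 - 1) / (R\<^sup>2 + 1))"
    using stereographic_height_bounds[of R] by (intro arccos_less_arccos) auto
  then show ?thesis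
    by (simp add: angle_of_radius_def)
qed

lemma angle_of_radius_surj:
  assumes "0 < r" "r < pi"
  obtains R where "0 \<le> R" "angle_of_radius R = r"
proof
  have c: "-1 < cos r" "cos r < 1"
    using assms cos_monotone_0_pi[of r pi] cos_monotone_0_pi[of 0 r] by auto
  \<comment> \<open>This is \<open>cot\<close> (r/2), the nonnegative solution of
    (\<open>R\<^sup>2\<close> - 1) / (\<open>R\<^sup>2\<close> + 1) = \<open>cos r\<close>.\<close>
  let ?R = "sqrt ((1 + cos r) / (1 - cos r))"
  show "0 \<le> ?R"
    using c by simp
  have sq: "?R\<^sup>2 = (1 + cos r) / (1 - cos r)"
    using c by simp
  have "(?R\<^sup>2 - 1) / (?R\<^sup>2 + 1) = cos r"
    unfolding sq using c by (simp add: field_simps)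
  then show "angle_of_radius ?R = r"
    using assms by (simp add: angle_of_radius_def arccos_cos)
qed

lemma vimage_spherical_ball_Infinity:
  assumes "0 \<le> R"
  shows "(Finite \<circ> f) -` spherical_ball Infinity (angle_of_radius R) = {z. R < cmod (f z)}"
  using assms by (auto simp: spherical_ball_def spherical_dist_Infinity angle_of_radius_less_iff)

text \<open>The angle strictly decreases in the modulus, so small spherical radii correspond to
  large \<open>R\<close>. Omission of \<open>Infinity\<close> is automatic for a function of the
  form \<open>Finite \<circ> f\<close>.\<close>

lemma baker_omitted_value_Infinity_iff:
  "baker_omitted_value (Finite \<circ> f) Infinity \<longleftrightarrow>
     (\<exists>R0\<ge>0. \<forall>R>R0. \<forall>C \<in> components (frontier {z. R < cmod (f z)}). bounded C)"
    (is "?bov \<longleftrightarrow> ?level")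
proof
  assume ?bov
  then obtain r0 where r0: "0 < r0" and
    bdd: "\<And>r C. \<lbrakk>0 < r; r < r0; C \<in> components (frontier ((Finite \<circ> f) -` spherical_ball Infinity r))\<rbrakk>
      \<Longrightarrow> bounded C"
    unfolding baker_omitted_value_def by blast
  \<comment> \<open>\<open>r0\<close> may exceed \<open>pi\<close>; this radius is at most
    \<open>r0\<close> and lies strictly between 0 and \<open>pi\<close>, so it is the angle of some
    modulus.\<close>
  have "0 < min r0 pi / 2" "min r0 pi / 2 < pi"
    using r0 pi_gt_zero by linarith+
  then obtain R0 where R0: "0 \<le> R0" "angle_of_radius R0 = min r0 pi / 2"
    by (rule angle_of_radius_surj)
  have "bounded C" if "R0 < R" "C \<in> components (frontier {z. R < cmod (f z)})" for R C
  proof (rule bdd)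
    have "angle_of_radius R < min r0 pi / 2"
      using that R0 angle_of_radius_less_iff[of R R0] by linarith
    then show "angle_of_radius R < r0"
      using r0 by linarith
    show "C \<in> components (frontier ((Finite \<circ> f) -` spherical_ball Infinity (angle_of_radius R)))"
      using that R0 by (subst vimage_spherical_ball_Infinity) auto
  qed (rule angle_of_radius_pos)
  with R0 show ?level
    by blast
next
  assume ?level
  then obtain R0 where R0: "0 \<le> R0" and
    bdd: "\<And>R C. \<lbrakk>R0 < R; C \<in> components (frontier {z. R < cmod (f z)})\<rbrakk> \<Longrightarrow> bounded C"
    by blast
  have "bounded C"
    if r: "0 < r" "r < angle_of_radius R0"
      and C: "C \<in> components (frontier ((Finite \<circ> f) -` spherical_ball Infinity r))" for r C
  proof -
    have "angle_of_radius R0 \<le> pi"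
      using stereographic_height_bounds[of R0] by (simp add: angle_of_radius_def arccos_ubound)
    with r have "r < pi"
      by simp
    with r obtain R where R: "0 \<le> R" "angle_of_radius R = r"
      using angle_of_radius_surj by blast
    show ?thesis
    proof (rule bdd)
      show "R0 < R"
        using r(2) angle_of_radius_less_iff[OF R(1) R0] unfolding R(2) by blast
      show "C \<in> components (frontier {z. R < cmod (f z)})"
        using C unfolding vimage_spherical_ball_Infinity[OF R(1), of f, unfolded R(2)] .
    qed
  qed
  then show ?bov
    unfolding baker_omitted_value_def omitted_value_def using angle_of_radius_pos[of R0] by auto
qed

section \<open>Unbounded curves in path connected sets\<close>

text \<open>Path number n is run through on the interval [n, n+1]. The pieces agree at the integers
  and each point of the half-line has a neighbourhood meeting only finitely many of them.\<close>

lemma continuous_on_path_sequence: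
  fixes g :: "nat \<Rightarrow> real \<Rightarrow> 'a::topological_space"
  assumes path: "\<And>n. path (g n)" and join: "\<And>n. pathfinish (g n) = pathstart (g (Suc n))"
  shows "continuous_on {0..} (\<lambda>t. g (nat \<lfloor>t\<rfloor>) (t - of_int \<lfloor>t\<rfloor>))"
proof -
  define c where "c t = g (nat \<lfloor>t\<rfloor>) (t - of_int \<lfloor>t\<rfloor>)" for t
  \<comment> \<open>The right endpoint is included: there the floor jumps to n + 1, and
    \<open>join\<close> identifies the start of the next path with the end of this one.\<close>
  have c_eq: "c t = g n (t - real n)" if "real n \<le> t" "t \<le> real n + 1" for n t
  proof (cases "t = real n + 1")
    case True
    then have floor: "\<lfloor>t\<rfloor> = int (Suc n)"
      by linarith
    have "nat \<lfloor>t\<rfloor> = Suc n" "t - of_int \<lfloor>t\<rfloor> = 0"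
      unfolding floor using True by simp_all
    then have "c t = g (Suc n) 0"
      by (simp only: c_def)
    also have "\<dots> = g n 1"
      using join[of n] by (simp add: pathfinish_def pathstart_def)
    finally show ?thesis
      using True by simp
  next
    case False
    then have "\<lfloor>t\<rfloor> = int n"
      using that by linarith
    then show ?thesis
      by (simp add: c_def)
  qed
  have piece: "continuous_on {real n..real n + 1} c" for n
  proof -
    have "continuous_on {real n..real n + 1} (\<lambda>t. g n (t - real n))"
      by (rule continuous_on_compose2[OF path[of n, unfolded path_def]])
        (auto intro!: continuous_intros)
    then show ?thesis
      by (rule continuous_on_eq) (use c_eq[of n] in simp)
  qed
  have initial: "continuous_on {0..real n} c" for n
  proof (induction n)
    case (Suc n)
    have "continuous_on ({0..real n} \<union> {real n..real n + 1}) c"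
      using Suc.IH piece[of n] by (intro continuous_on_closed_Un) auto
    moreover have "{0..real n} \<union> {real n..real n + 1} = {0..real n + 1}"
      by (intro ivl_disj_un_two_touch) auto
    ultimately show ?case
      by (simp add: add.commute)
  qed simp
  have "continuous (at t within {0..}) c" if "t \<in> {0..}" for t
  proof -
    obtain n where n: "t < real n"
      using reals_Archimedean2 by blast
    then have "at t within {0..} = at t within {0..real n}"
      by (intro at_within_nhd[of t "{..<real n}"]) auto
    moreover have "continuous (at t within {0..real n}) c"
      using initial[of n] n that unfolding continuous_on_eq_continuous_within by simp
    ultimately show ?thesis
      by metis
  qed
  then have "continuous_on {0..} c"
    by (simp add: continuous_on_eq_continuous_within)
  then show ?thesis
    by (simp add: c_def[abs_def])
qed

text \<open>Points \<open>z n\<close> of \<open>S\<close> with modulus above n are joined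
  successively by paths in \<open>S\<close>; the infinite concatenation passes through all of
  them.\<close>

lemma path_connected_unbounded_curve:
  fixes S :: "complex set"
  assumes "path_connected S" "\<not> bounded S"
  obtains \<Gamma> where "\<Gamma> \<subseteq> S" "unbounded_curve \<Gamma>"
proof -
  have "\<exists>z\<in>S. real n < cmod z" for n
    using assms(2) by (meson boundedI not_less)
  then obtain z where z: "\<And>n. z n \<in> S" "\<And>n. real n < cmod (z n)"
    by metis
  have "\<exists>g. path g \<and> path_image g \<subseteq> S \<and> pathstart g = z n \<and> pathfinish g = z (Suc n)" for n
    using assms(1) z(1) unfolding path_connected_def by blast
  then obtain g where g: "\<And>n. path (g n)" "\<And>n. path_image (g n) \<subseteq> S"
      "\<And>n. pathstart (g n) = z n" "\<And>n. pathfinish (g n) = z (Suc n)"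
    by metis
  define c where "c t = g (nat \<lfloor>t\<rfloor>) (t - of_int \<lfloor>t\<rfloor>)" for t
  have cont: "continuous_on {0..} c"
    unfolding c_def by (rule continuous_on_path_sequence) (simp_all add: g)
  have "c t \<in> S" for t
  proof -
    have "t - of_int \<lfloor>t\<rfloor> \<in> {0..1}"
      by (simp; linarith)
    then show ?thesis
      using g(2)[of "nat \<lfloor>t\<rfloor>"] unfolding c_def path_image_def by blast
  qed
  moreover have "\<not> bounded (c ` {0..})"
  proof
    assume "bounded (c ` {0..})"
    then obtain B where B: "\<And>t. 0 \<le> t \<Longrightarrow> cmod (c t) \<le> B"
      by (auto simp: bounded_iff)
    obtain n where "B < real n"
      using reals_Archimedean2 by blast
    moreover have "c (real n) = z n"
      using g(3)[of n] by (simp add: c_def pathstart_def)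
    ultimately show False
      using B[of "real n"] z(2)[of n] by simp
  qed
  moreover have "\<exists>(I :: real set) h. is_interval I \<and> continuous_on I h \<and> c ` {0..} = h ` I"
    using cont is_interval_ci[of 0] by (intro exI[of _ "{0..}"] exI[of _ c]) simp
  ultimately show thesis
    by (intro that[of "c ` {0..}"]) (simp_all add: unbounded_curve_def image_subset_iff)
qed

section \<open>Level sets of entire functions\<close>

lemma frontier_superlevel_subset:
  fixes f :: "'a::topological_space \<Rightarrow> 'b::real_normed_vector"
  assumes "continuous_on UNIV f"
  shows "frontier {z. R < norm (f z)} \<subseteq> {z. norm (f z) = R}"
proof -
  have "open {z. R < norm (f z)}" "closed {z. R \<le> norm (f z)}"
    using assms by (auto intro!: open_Collect_less closed_Collect_le continuous_intros)
  moreover from this(2) have "closure {z. R < norm (f z)} \<subseteq> {z. R \<le> norm (f z)}"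
    by (intro closure_minimal) auto
  ultimately show ?thesis
    by (auto simp: frontier_def interior_open)
qed

lemma frontier_superlevel:
  assumes holf: "f holomorphic_on UNIV" and nonconst: "\<not> f constant_on UNIV"
  shows "frontier {z. R < cmod (f z)} = {z. cmod (f z) = R}"
proof
  show "frontier {z. R < cmod (f z)} \<subseteq> {z. cmod (f z) = R}"
    using holf by (intro frontier_superlevel_subset holomorphic_on_imp_continuous_on)
  show "{z. cmod (f z) = R} \<subseteq> frontier {z. R < cmod (f z)}"
  proof clarify
    fix w assume w: "R = cmod (f w)"
    have "w \<in> closure {z. R < cmod (f z)}"
    \<comment> \<open>Otherwise w has an open neighbourhood on which the modulus of \<open>f\<close>
      is at most \<open>R\<close>, its value at w, and the maximum principle makes \<open>f\<close>
      constant.\<close>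
    proof (rule ccontr)
      assume "w \<notin> closure {z. R < cmod (f z)}"
      then have "f constant_on UNIV"
        using w closure_subset[of "{z. R < cmod (f z)}"]
        by (intro maximum_modulus_principle[OF holf, of "- closure {z. R < cmod (f z)}" w])
          (auto simp: not_less[symmetric])
      with nonconst show False ..
    qed
    moreover have "w \<notin> interior {z. R < cmod (f z)}"
      using w interior_subset[of "{z. R < cmod (f z)}"] by auto
    ultimately show "w \<in> frontier {z. cmod (f w) < cmod (f z)}"
      using w by (simp add: frontier_def)
  qed
qed

text \<open>By the maximum principle the inside of a loop in \<open>W\<close> also lies in the
  sublevel set, hence in \<open>W\<close>. A point off \<open>W\<close> is therefore outside every
  such loop and has winding number zero.\<close>

lemma simply_connected_sublevel_component:
  assumes holf: "f holomorphic_on UNIV" and W: "W \<in> components {z. cmod (f z) < R}"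
  shows "simply_connected W"
proof -
  have contf: "continuous_on A f" for A
    using holf holomorphic_on_imp_continuous_on holomorphic_on_subset by blast
  have "open {z. cmod (f z) < R}"
    by (intro open_Collect_less continuous_intros contf)
  then have "open W"
    using W open_components by blast
  moreover have "winding_number g z = 0"
    if g: "path g" "path_image g \<subseteq> W" "pathfinish g = pathstart g" and z: "z \<notin> W" for g z
  proof -
    let ?P = "path_image g"
    have P: "compact ?P" "connected ?P" "?P \<noteq> {}"
      using g by auto
    have sub: "?P \<subseteq> {z. cmod (f z) < R}"
      using g W in_components_subset by blast
    \<comment> \<open>An attained maximum is itself below \<open>R\<close>, which keeps the
      inequality strict inside the loop.\<close>
    have "\<exists>x\<in>?P. \<forall>y\<in>?P. cmod (f y) \<le> cmod (f x)"
      by (intro continuous_attains_sup P continuous_on_norm contf)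
    then obtain x where x: "x \<in> ?P" "\<And>y. y \<in> ?P \<Longrightarrow> cmod (f y) \<le> cmod (f x)"
      by blast
    have "cmod (f y) < R" if "y \<in> inside ?P" for y
    proof -
      have "cmod (f y) \<le> cmod (f x)"
      proof (rule maximum_modulus_frontier[OF _ contf _ _ that])
        show "f holomorphic_on interior (inside ?P)"
          using holf holomorphic_on_subset by blast
        show "bounded (inside ?P)"
          using P by (simp add: bounded_inside compact_imp_bounded)
        show "cmod (f u) \<le> cmod (f x)" if "u \<in> frontier (inside ?P)" for u
          using that x(2) frontier_inside_subset P(1) compact_imp_closed by blast
      qed
      then show ?thesis
        using x(1) sub by auto
    qed
    with sub have "?P \<union> inside ?P \<subseteq> {z. cmod (f z) < R}"
      by blast
    moreover have "connected (?P \<union> inside ?P)"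
      using P by (intro connected_with_inside compact_imp_closed)
    moreover have "W \<inter> (?P \<union> inside ?P) \<noteq> {}"
      using P(3) g(2) by blast
    ultimately have "?P \<union> inside ?P \<subseteq> W"
      using components_maximal[OF W] by blast
    then have "z \<in> outside ?P"
      using z unfolding union_with_inside by blast
    then show ?thesis
      using g by (simp add: winding_number_zero_in_outside)
  qed
  ultimately show ?thesis
    using W in_components_connected by (auto simp: simply_connected_eq_winding_number_zero)
qed

lemma transcendental_entire_not_constant:
  assumes "transcendental_entire f"
  shows "\<not> f constant_on UNIV"
proof
  assume "f constant_on UNIV"
  then obtain a where "\<And>z. f z = a"
    by (auto simp: constant_on_def)
  then have "\<forall>z. f z = poly [:a:] z"
    by simp
  with assms show False
    unfolding transcendental_entire_def by blast
qed

theorem theorem3p1: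
  fixes f :: "complex \<Rightarrow> complex"
  assumes "transcendental_entire f"
  shows "(\<forall>\<Gamma>. unbounded_curve \<Gamma> \<longrightarrow> \<not> bounded (f ` \<Gamma>)) \<longleftrightarrow>
         baker_omitted_value (Finite \<circ> f) Infinity"
proof -
  have holf: "f holomorphic_on UNIV"
    using assms by (simp add: transcendental_entire_def)
  have nonconst: "\<not> f constant_on UNIV"
    using assms by (rule transcendental_entire_not_constant)
  have contf: "continuous_on UNIV f"
    using holf by (rule holomorphic_on_imp_continuous_on)
  have open_sub: "open {z. cmod (f z) < R}" for R
    by (intro open_Collect_less continuous_intros contf)
  have "(\<forall>\<Gamma>. unbounded_curve \<Gamma> \<longrightarrow> \<not> bounded (f ` \<Gamma>)) \<longleftrightarrow>
      (\<exists>R0\<ge>0. \<forall>R>R0. \<forall>C \<in> components {z. cmod (f z) = R}. bounded C)"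
    (is "?curves \<longleftrightarrow> ?level")
  proof
    assume curves: ?curves
    have "bounded C" if C: "C \<in> components {z. cmod (f z) = R}" for R C
    proof (rule ccontr)
      assume unb: "\<not> bounded C"
      \<comment> \<open>Passing from the level set to an open set makes connected components path
        connected.\<close>
      have "C \<subseteq> {z. cmod (f z) < R + 1}"
        using in_components_subset[OF C] by auto
      then obtain W where W: "W \<in> components {z. cmod (f z) < R + 1}" "C \<subseteq> W"
        using exists_component_superset[of C "{z. cmod (f z) < R + 1}"] C
          in_components_connected in_components_nonempty by blast
      have "path_connected W"
        using W open_components[OF open_sub] in_components_connected connected_open_path_connected
        by blast
      moreover have "\<not> bounded W"
        using unb W(2) bounded_subset by blast
      ultimately obtain \<Gamma> where \<Gamma>: "\<Gamma> \<subseteq> W" "unbounded_curve \<Gamma>"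
        by (rule path_connected_unbounded_curve)
      have "\<Gamma> \<subseteq> {z. cmod (f z) < R + 1}"
        using \<Gamma>(1) in_components_subset[OF W(1)] by blast
      then have "bounded (f ` \<Gamma>)"
        by (intro boundedI[of _ "R + 1"]) (auto intro: less_imp_le)
      with \<Gamma> curves show False
        by blast
    qed
    then show ?level
      \<comment> \<open>The argument works for every \<open>R\<close>, so the threshold 0 will
        do.\<close>
      by (intro exI[of _ 0]) auto
  next
    assume ?level
    then obtain R0 where bdd: "\<And>R C. \<lbrakk>R0 < R; C \<in> components {z. cmod (f z) = R}\<rbrakk> \<Longrightarrow> bounded C"
      by blast
    show ?curves
    proof (intro allI impI notI)
      fix \<Gamma> assume "unbounded_curve \<Gamma>" and "bounded (f ` \<Gamma>)"
      then have \<Gamma>: "connected \<Gamma>" "\<not> bounded \<Gamma>"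
        by (auto simp: unbounded_curve_def is_interval_connected connected_continuous_image)
      obtain M where M: "\<And>z. z \<in> \<Gamma> \<Longrightarrow> cmod (f z) \<le> M"
        using \<open>bounded (f ` \<Gamma>)\<close> by (auto simp: bounded_iff)
      \<comment> \<open>Above \<open>R0\<close>, so that the hypothesis applies to this level, and
        above \<open>M\<close>, so that \<Gamma> lies in the open sublevel set.\<close>
      define R where "R = max R0 M + 1"
      have R: "R0 < R" "M < R"
        by (auto simp: R_def)
      have "\<Gamma> \<subseteq> {z. cmod (f z) < R}" "\<Gamma> \<noteq> {}"
        using M R \<Gamma> by force+
      then obtain W where W: "W \<in> components {z. cmod (f z) < R}" "\<Gamma> \<subseteq> W"
        using exists_component_superset[of \<Gamma> "{z. cmod (f z) < R}"] \<Gamma> by blast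
      have W_sub: "W \<subseteq> {z. cmod (f z) < R}"
        using W(1) by (rule in_components_subset)
      have "\<not> bounded W"
        using \<Gamma> W(2) bounded_subset by blast
      moreover have "open W"
        using open_components[OF open_sub W(1)] .
      moreover have "simply_connected W"
        using holf W(1) by (rule simply_connected_sublevel_component)
      \<comment> \<open>For an open connected unbounded set, simple connectivity is equivalent to
        all components of the frontier being unbounded.\<close>
      ultimately have unb: "\<And>C. C \<in> components (frontier W) \<Longrightarrow> \<not> bounded C"
        by (simp add: simply_connected_eq_frontier_properties)
      \<comment> \<open>Unboundedness of the frontier components yields a contradiction only if
        there is one, so the frontier must be shown nonempty.\<close>
      have "W \<noteq> UNIV"
      proof
        assume "W = UNIV"
        then have "bounded (range f)"
          using W_sub by (intro boundedI[of _ R]) (auto intro: less_imp_le)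
        with Liouville_theorem[OF holf] nonconst show False
          by blast
      qed
      moreover have "W \<noteq> {}"
        using W(1) in_components_nonempty by blast
      ultimately have "frontier W \<noteq> {}"
        by (simp add: frontier_eq_empty)
      then obtain C where C: "C \<in> components (frontier W)"
        by (metis components_eq_empty ex_in_conv)
      have "frontier W \<subseteq> {z. cmod (f z) = R}"
      proof -
        have "closure {z. cmod (f z) < R} \<subseteq> {z. cmod (f z) \<le> R}"
          by (intro closure_minimal closed_Collect_le continuous_intros contf) auto
        then have "frontier {z. cmod (f z) < R} \<subseteq> {z. cmod (f z) = R}"
          by (auto simp: frontier_def interior_open[OF open_sub])
        then show ?thesis
          using frontier_of_components_subset[OF W(1)] by blast
      qed
      then have "C \<subseteq> {z. cmod (f z) = R}"
        using in_components_subset[OF C] by blast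
      \<comment> \<open>The unbounded \<open>C\<close> is connected, so the component of the level
        set containing it is unbounded too, against \<open>bdd\<close>.\<close>
      then obtain D where "D \<in> components {z. cmod (f z) = R}" "C \<subseteq> D"
        using exists_component_superset[of C "{z. cmod (f z) = R}"] C
          in_components_connected in_components_nonempty by blast
      then show False
        using bdd[OF R(1)] unb[OF C] bounded_subset by blast
    qed
  qed
  then show ?thesis
    by (simp add: baker_omitted_value_Infinity_iff frontier_superlevel[OF holf nonconst])
qed

end
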